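(* Let $\alpha\in]0;1[$ be a fixed constant, let $\sigma_0^2>0$, and let $\dot\Upsilon$ be the test of $H_0:\sigma^2=\sigma_0^2$ versus $H_1:\sigma^2>\sigma_0^2$ which rejects $H_0$ if $$\dot S\ \geq\ \dot z_{1-\alpha}:=\frac{\sigma_0^2}{n}\,q_{\chi^2_n,\,1-\alpha}.$$ Then the test $\dot\Upsilon$ is of Type I error $\alpha$, i.e. $\mathbb{P}_{\sigma_0^2}(\dot S\geq\dot z_{1-\alpha})=\alpha$, and therefore it is of level $\alpha$. Let $\beta\in]0;1[$ be a constant such that $1-\beta\geq\alpha$. For all $\sigma^2>0$ such that $$\sigma^2\ \geq\ \frac{q_{\chi^2_n,\,1-\alpha}}{q_{\chi^2_n,\,\beta}}\,\sigma_0^2,$$ the test $\dot\Upsilon$ satisfies $\mathbb{P}_{\sigma^2}(\dot\Upsilon\text{ accepts }H_0)\leq\beta$. This condition on $\sigma^2$ is necessary and sufficient for $\mathbb{P}_{\sigma^2}(\dot\Upsilon\text{ accepts }H_0)\leq\beta$.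
   Context: Consider the one-dimensional SDE $dX_t=b_t\,dt+\sigma\,dW_t$, $X_0=x_0$, $t>0$, where $b_t$ is a known deterministic real drift function depending only on time (integrable on $[0,T]$), $\sigma$ is a constant diffusion coefficient and $W$ is a one-dimensional Brownian motion. The process is observed at times $i\Delta$, $i=0,\dots,n$, with fixed $\Delta>0$ and $n\Delta=T$. $\mathbb{P}_{\sigma^2}$ denotes the probability when the squared diffusion coefficient equals $\sigma^2$. The centered normalized increments are $$\dot\xi_i=\frac{X_{i\Delta}-X_{(i-1)\Delta}-\int_{(i-1)\Delta}^{i\Delta}b_s\,ds}{\sqrt\Delta},\quad i=1,\dots,n,$$ and the test statistic is $\dot S=\frac1n\sum_{i=1}^n\dot\xi_i^2$. $q_{\chi^2_n,\beta}$ is the quantile of order $\beta$ of the central chi-squared distribution with $n$ degrees of freedom. A test accepts $H_0$ when it does not reject it; level $\alpha$ means that the probability of rejecting under $H_0$ is at most $\alpha$. *)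

theory Defs
  imports "HOL-Probability.Probability"
begin

locale brownian_motion = prob_space M for M :: "'a measure" +
  fixes W :: "real \<Rightarrow> 'a \<Rightarrow> real"
  assumes random_variable: "\<And>t. 0 \<le> t \<Longrightarrow> W t \<in> borel_measurable M"
    and start: "AE \<omega> in M. W 0 \<omega> = 0"
    and indep_increments:
      "\<And>t :: nat \<Rightarrow> real. 0 \<le> t 0 \<Longrightarrow> incseq t \<Longrightarrow>
         indep_vars (\<lambda>_. borel) (\<lambda>i \<omega>. W (t (Suc i)) \<omega> - W (t i) \<omega>) UNIV"
    and normal_increments:
      "\<And>s t. 0 \<le> s \<Longrightarrow> s < t \<Longrightarrow>
         distributed M lborel (\<lambda>\<omega>. W t \<omega> - W s \<omega>) (normal_density 0 (sqrt (t - s)))"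
    and continuous_paths: "AE \<omega> in M. continuous_on {0..} (\<lambda>t. W t \<omega>)"

text \<open>
  \<open>X\<close> solves \<open>dX\<^sub>t = b\<^sub>t dt + \<sigma> dW\<^sub>t\<close>, \<open>X\<^sub>0 = x0\<close> on \<open>[0, T]\<close>. The integrand of the
  stochastic integral is the constant \<open>\<sigma>\<close>, hence a simple process, and its Ito integral
  over \<open>[0, t]\<close> is by definition \<open>\<sigma> (W\<^sub>t - W\<^sub>0)\<close>.
\<close>

definition sde_solution ::
    "'a measure \<Rightarrow> (real \<Rightarrow> 'a \<Rightarrow> real) \<Rightarrow> (real \<Rightarrow> real) \<Rightarrow> real \<Rightarrow> real \<Rightarrow> real \<Rightarrow>
     (real \<Rightarrow> 'a \<Rightarrow> real) \<Rightarrow> bool" where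
  "sde_solution M W b \<sigma> x0 T X \<longleftrightarrow>
     (\<forall>t\<in>{0..T}. X t \<in> borel_measurable M) \<and>
     (AE \<omega> in M. \<forall>t\<in>{0..T}.
        X t \<omega> = x0 + (LINT s:{0..t}|lebesgue. b s) + \<sigma> * (W t \<omega> - W 0 \<omega>))"

text \<open>
  The statistical model: one process \<open>X\<close> on one measurable space, and probabilities \<open>P v\<close>
  indexed by the squared diffusion coefficient \<open>v > 0\<close>. The driving Brownian motion may
  depend on \<open>v\<close>, as it must when \<open>X\<close> is the coordinate process on path space.
\<close>

definition diffusion_model ::
    "(real \<Rightarrow> 'a measure) \<Rightarrow> (real \<Rightarrow> real) \<Rightarrow> real \<Rightarrow> real \<Rightarrow> (real \<Rightarrow> 'a \<Rightarrow> real) \<Rightarrow> bool" where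
  "diffusion_model P b x0 T X \<longleftrightarrow>
     (\<forall>v>0. \<forall>w>0. sets (P v) = sets (P w)) \<and>
     (\<forall>v>0. \<exists>W \<sigma>. \<sigma>\<^sup>2 = v \<and> brownian_motion (P v) W \<and> sde_solution (P v) W b \<sigma> x0 T X)"

definition centered_increment ::
    "(real \<Rightarrow> real) \<Rightarrow> (real \<Rightarrow> 'a \<Rightarrow> real) \<Rightarrow> real \<Rightarrow> nat \<Rightarrow> 'a \<Rightarrow> real" where
  "centered_increment b X \<Delta> i \<omega> =
     (X (real i * \<Delta>) \<omega> - X ((real i - 1) * \<Delta>) \<omega>
        - (LINT s:{(real i - 1) * \<Delta>..real i * \<Delta>}|lebesgue. b s)) / sqrt \<Delta>"

definition test_statistic ::
    "(real \<Rightarrow> real) \<Rightarrow> (real \<Rightarrow> 'a \<Rightarrow> real) \<Rightarrow> real \<Rightarrow> nat \<Rightarrow> 'a \<Rightarrow> real" where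
  "test_statistic b X \<Delta> n \<omega> = (\<Sum>i=1..n. (centered_increment b X \<Delta> i \<omega>)\<^sup>2) / real n"

text \<open>The law of the sum of squares of \<open>n\<close> independent standard normal variables.\<close>

definition chi_squared :: "nat \<Rightarrow> real measure" where
  "chi_squared n =
     distr (\<Pi>\<^sub>M i\<in>{..<n}. density lborel std_normal_density) borel (\<lambda>z. \<Sum>i<n. (z i)\<^sup>2)"

definition quantile :: "real measure \<Rightarrow> real \<Rightarrow> real" where
  "quantile \<mu> \<beta> = Inf {x. \<beta> \<le> cdf \<mu> x}"

definition critical_value :: "real \<Rightarrow> nat \<Rightarrow> real \<Rightarrow> real" where
  "critical_value v0 n \<alpha> = v0 / real n * quantile (chi_squared n) (1 - \<alpha>)"

definition rejects ::
    "(real \<Rightarrow> real) \<Rightarrow> (real \<Rightarrow> 'a \<Rightarrow> real) \<Rightarrow> real \<Rightarrow> nat \<Rightarrow> real \<Rightarrow> real \<Rightarrow> 'a \<Rightarrow> bool" where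
  "rejects b X \<Delta> n v0 \<alpha> \<omega> \<longleftrightarrow> test_statistic b X \<Delta> n \<omega> \<ge> critical_value v0 n \<alpha>"

text \<open>\<open>R\<close> is the rejection event of a test, \<open>H0\<close> the set of parameters of the null hypothesis.\<close>

definition has_level ::
    "(real \<Rightarrow> 'a measure) \<Rightarrow> real set \<Rightarrow> ('a \<Rightarrow> bool) \<Rightarrow> real \<Rightarrow> bool" where
  "has_level P H0 R \<alpha> \<longleftrightarrow> (\<forall>v\<in>H0. \<P>(\<omega> in P v. R \<omega>) \<le> \<alpha>)"

end

theory Submission
  imports Defs
begin

text \<open>
  Almost surely \<open>n S / \<sigma>\<^sup>2\<close> is the sum of the squared standardized Brownian increments, so under
  \<open>P\<^sub>v\<close> it has the law \<open>\<chi>\<^sup>2\<^sub>n\<close>. The distribution function \<open>F\<close> of \<open>\<chi>\<^sup>2\<^sub>n\<close> is continuous and strictly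
  increasing on \<open>[0, \<infinity>)\<close>, so quantiles are genuine inverses of \<open>F\<close>. The acceptance probability
  is \<open>F (v0 q / v)\<close> with \<open>q\<close> the quantile of order \<open>1 - \<alpha>\<close>, and comparing it with
  \<open>\<beta> = F (q\<^sub>\<beta>)\<close> amounts to comparing the arguments.
\<close>

section \<open>Quantiles as inverses of a distribution function\<close>

lemma quantile_eqI:
  assumes "finite_borel_measure \<mu>" "cdf \<mu> x = \<beta>" "\<And>y. y < x \<Longrightarrow> cdf \<mu> y < \<beta>"
  shows "quantile \<mu> \<beta> = x"
proof -
  interpret finite_borel_measure \<mu> by fact
  have "{y. \<beta> \<le> cdf \<mu> y} = {x..}"
    using assms(2,3) cdf_nondecreasing by (force simp: not_less[symmetric])
  then show ?thesis
    by (simp add: quantile_def)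
qed

text \<open>Without atoms the distribution function is continuous, so the intermediate value theorem
  yields a point where it equals \<open>\<beta>\<close>. Strict growth on the nonnegative half-line
  makes this the first such point, hence the infimum in \<open>quantile\<close>.\<close>

lemma real_distribution_cdf_quantile:
  assumes "real_distribution \<mu>"
    and no_atoms: "\<And>x. measure \<mu> {x} = 0"
    and strict: "\<And>x y. 0 \<le> x \<Longrightarrow> x < y \<Longrightarrow> cdf \<mu> x < cdf \<mu> y"
    and zero: "cdf \<mu> 0 = 0"
    and \<beta>: "0 < \<beta>" "\<beta> < 1"
  shows "cdf \<mu> (quantile \<mu> \<beta>) = \<beta>" and "0 < quantile \<mu> \<beta>"
proof -
  interpret real_distribution \<mu> by fact
  \<comment> \<open>The limit 1 at infinity exceeds \<open>\<beta>\<close>, which gives the upper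
    end \<open>y\<close> of the bracket; the lower end is 0, where the distribution function
    vanishes.\<close>
  have "\<forall>\<^sub>F x in at_top. \<beta> < cdf \<mu> x"
    using cdf_lim_at_top_prob \<beta>(2) by (rule order_tendstoD)
  then obtain y where y: "0 \<le> y" "\<beta> < cdf \<mu> y"
    by (metis eventually_at_top_linorder linear)
  have "\<exists>x\<ge>0. x \<le> y \<and> cdf \<mu> x = \<beta>"
    using y \<beta> zero isCont_cdf no_atoms by (intro IVT) auto
  then obtain x where x: "0 \<le> x" "cdf \<mu> x = \<beta>"
    by blast
  with zero \<beta>(1) have "0 < x"
    by (cases "x = 0") auto
  \<comment> \<open>Strict growth is available only from 0 on; for negative \<open>z\<close>,
    monotonicity gives a value of at most \<open>cdf \<mu> 0 = 0\<close>.\<close>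
  have "cdf \<mu> z < \<beta>" if "z < x" for z
    using strict[of z x] that x zero \<beta>(1) cdf_nondecreasing[of z 0] by (cases "0 \<le> z") auto
  then have "quantile \<mu> \<beta> = x"
    using x(2) by (intro quantile_eqI) unfold_locales
  with x \<open>0 < x\<close> show "cdf \<mu> (quantile \<mu> \<beta>) = \<beta>" "0 < quantile \<mu> \<beta>"
    by auto
qed

section \<open>Continuity and strict growth of the chi-squared distribution function\<close>

abbreviation std_normal :: "real measure" where
  "std_normal \<equiv> density lborel std_normal_density"

lemma product_prob_space_std_normal: "product_prob_space (\<lambda>_. std_normal)"
  by (intro product_prob_spaceI prob_space_normal_density) simp

lemma measurable_sum_squares:
  assumes "\<And>i. i \<in> I \<Longrightarrow> sets (N i) = sets (borel :: real measure)"
  shows "(\<lambda>z. \<Sum>i\<in>I. (z i)\<^sup>2) \<in> borel_measurable (Pi\<^sub>M I N)"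
proof (intro borel_measurable_sum borel_measurable_power)
  fix i assume "i \<in> I"
  then show "(\<lambda>z. z i) \<in> borel_measurable (Pi\<^sub>M I N)"
    using measurable_component_singleton[of i I N] assms
    by (metis measurable_cong_sets)
qed

lemma real_distribution_chi_squared: "real_distribution (chi_squared n)"
proof -
  interpret product_prob_space "\<lambda>_. std_normal" "{..<n}"
    by (rule product_prob_space_std_normal)
  show ?thesis
    unfolding chi_squared_def
    by (intro real_distribution_distr measurable_sum_squares) simp
qed

lemma emeasure_chi_squared:
  assumes "A \<in> sets borel"
  shows "emeasure (chi_squared n) A =
    emeasure (\<Pi>\<^sub>M i\<in>{..<n}. std_normal)
      ((\<lambda>z. \<Sum>i<n. (z i)\<^sup>2) -` A \<inter> space (\<Pi>\<^sub>M i\<in>{..<n}. std_normal))"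
  unfolding chi_squared_def by (rule emeasure_distr[OF measurable_sum_squares assms]) simp

text \<open>By Fubini the last coordinate is integrated first. With the others fixed it has to solve
  a quadratic equation, whose at most two roots form a null set of the normal law.\<close>

lemma chi_squared_no_atoms:
  assumes "n \<ge> 1"
  shows "emeasure (chi_squared n) {c} = 0"
proof -
  interpret product_prob_space "\<lambda>_. std_normal" UNIV
    by (rule product_prob_space_std_normal)
  obtain m where n: "n = Suc m"
    using assms by (cases n) auto
  have ins: "{..<n} = insert m {..<m}"
    by (auto simp: n)
  define S where "S = (\<lambda>z :: nat \<Rightarrow> real. \<Sum>i<n. (z i)\<^sup>2)"
  have S[measurable]: "S \<in> borel_measurable (\<Pi>\<^sub>M i\<in>{..<n}. std_normal)"
    unfolding S_def by (intro measurable_sum_squares) simp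
  have "emeasure (chi_squared n) {c} =
      (\<integral>\<^sup>+ z. indicator {c} (S z) \<partial>(\<Pi>\<^sub>M i\<in>{..<n}. std_normal))"
    unfolding chi_squared_def S_def[symmetric]
    by (subst nn_integral_indicator[symmetric], simp, subst nn_integral_distr) simp_all
  also have "\<dots> = (\<integral>\<^sup>+ z. \<integral>\<^sup>+ y. indicator {c} (S (z(m := y))) \<partial>std_normal \<partial>(\<Pi>\<^sub>M i\<in>{..<m}. std_normal))"
    unfolding ins using S
    by (intro product_nn_integral_insert) (auto simp: ins)
  also have "\<dots> = (\<integral>\<^sup>+ z. 0 \<partial>(\<Pi>\<^sub>M i\<in>{..<m}. std_normal))"
  proof (rule nn_integral_cong)
    fix z :: "nat \<Rightarrow> real"
    let ?d = "c - (\<Sum>i<m. (z i)\<^sup>2)"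
    have "indicator {c} (S (z(m := y))) = (indicator {y. y\<^sup>2 = ?d} y :: ennreal)" for y
      by (auto simp: S_def n indicator_def)
    \<comment> \<open>This also covers negative \<open>?d\<close>: the left side is then empty,
      whatever value \<open>sqrt ?d\<close> takes.\<close>
    moreover have "{y. y\<^sup>2 = ?d} \<subseteq> {sqrt ?d, - sqrt ?d}"
    proof
      fix y assume "y \<in> {y. y\<^sup>2 = ?d}"
      then have "sqrt ?d = \<bar>y\<bar>"
        by (metis mem_Collect_eq real_sqrt_abs)
      then show "y \<in> {sqrt ?d, - sqrt ?d}"
        by auto
    qed
    then have fin: "finite {y. y\<^sup>2 = ?d}"
      by (rule finite_subset) simp
    moreover have "emeasure std_normal {y. y\<^sup>2 = ?d} = 0"
    proof -
      have "absolutely_continuous lborel std_normal"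
        by (rule absolutely_continuousI_density) simp
      moreover have "{y. y\<^sup>2 = ?d} \<in> null_sets lborel"
        using fin by (rule finite_imp_null_set_lborel)
      ultimately show ?thesis
        unfolding absolutely_continuous_def by auto
    qed
    moreover from fin have "{y. y\<^sup>2 = ?d} \<in> sets std_normal"
      using finite_imp_null_set_lborel by auto
    ultimately show "(\<integral>\<^sup>+ y. indicator {c} (S (z(m := y))) \<partial>std_normal) = 0"
      by simp
  qed
  finally show ?thesis
    by simp
qed

text \<open>The density vanishes nowhere, so a null set of the normal law is also Lebesgue null,
  which a nondegenerate interval is not.\<close>

lemma emeasure_std_normal_interval_pos:
  assumes "a < b"
  shows "emeasure std_normal {a<..<b} > 0"
proof (rule ccontr)
  assume "\<not> ?thesis"
  then have "{a<..<b} \<in> null_sets std_normal"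
    by (auto simp: null_sets_def)
  then have "AE x in lborel. x \<in> {a<..<b} \<longrightarrow> ennreal (std_normal_density x) = 0"
    by (subst (asm) null_sets_density_iff) auto
  then have "AE x in lborel. x \<notin> {a<..<b}"
    by eventually_elim (use normal_density_pos[of 1 0] in \<open>auto simp: less_le\<close>)
  then have "{a<..<b} \<in> null_sets lborel"
    by (subst (asm) AE_iff_null_sets[symmetric]) auto
  with assms show False
    by (auto simp: null_sets_def)
qed

text \<open>The open cube with side \<open>?J\<close> in each of the \<open>n\<close> coordinates
  has positive product measure, and the sum of squares maps it into the interval: each square lies
  between \<open>a / n\<close> and \<open>b / n\<close>.\<close>

lemma emeasure_chi_squared_interval_pos:
  assumes "n \<ge> 1" "0 \<le> a" "a < b"
  shows "emeasure (chi_squared n) {a<..<b} > 0"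
proof -
  interpret product_prob_space "\<lambda>_. std_normal" UNIV
    by (rule product_prob_space_std_normal)
  let ?J = "{sqrt (a / n)<..<sqrt (b / n)}"
  let ?P = "\<Pi>\<^sub>M i\<in>{..<n}. std_normal"
  have "sqrt (a / n) < sqrt (b / n)"
    using assms by (simp add: divide_strict_right_mono)
  then have "emeasure std_normal ?J \<noteq> 0"
    using emeasure_std_normal_interval_pos by (metis less_irrefl)
  then have "(\<Prod>i\<in>I. emeasure std_normal ?J) \<noteq> 0" for I :: "nat set"
    by (induction I rule: infinite_finite_induct)
      (simp_all only: prod.insert prod.empty prod.infinite mult_eq_0_iff one_neq_zero, simp_all)
  moreover have "emeasure ?P (Pi\<^sub>E {..<n} (\<lambda>_. ?J)) = (\<Prod>i\<in>{..<n}. emeasure std_normal ?J)"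
    by (rule emeasure_PiM) simp_all
  ultimately have "0 < emeasure ?P (Pi\<^sub>E {..<n} (\<lambda>_. ?J))"
    by (simp only: zero_less_iff_neq_zero not_False_eq_True)
  also have "\<dots> \<le> emeasure ?P ((\<lambda>z. \<Sum>i<n. (z i)\<^sup>2) -` {a<..<b} \<inter> space ?P)"
  proof (rule emeasure_mono)
    show "Pi\<^sub>E {..<n} (\<lambda>_. ?J) \<subseteq> (\<lambda>z. \<Sum>i<n. (z i)\<^sup>2) -` {a<..<b} \<inter> space ?P"
    proof
      fix z assume z: "z \<in> Pi\<^sub>E {..<n} (\<lambda>_. ?J)"
      have bounds: "a / n < (z i)\<^sup>2" "(z i)\<^sup>2 < b / n" if "i < n" for i
      proof -
        have "sqrt (a / n) < z i" "z i < sqrt (b / n)"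
          using PiE_mem[OF z, of i] that by simp_all
        \<comment> \<open>Squaring preserves strict inequalities only between nonnegative numbers;
          this is where \<open>0 \<le> a\<close> enters.\<close>
        moreover have "0 \<le> sqrt (a / n)"
          using assms by simp
        ultimately have "(sqrt (a / n))\<^sup>2 < (z i)\<^sup>2" "(z i)\<^sup>2 < (sqrt (b / n))\<^sup>2"
          by - (rule power_strict_mono; linarith)+
        then show "a / n < (z i)\<^sup>2" "(z i)\<^sup>2 < b / n"
          using assms by simp_all
      qed
      have "{..<n} \<noteq> {}"
        using assms(1) by (simp add: lessThan_empty_iff)
      then have "(\<Sum>i<n. a / n) < (\<Sum>i<n. (z i)\<^sup>2)" "(\<Sum>i<n. (z i)\<^sup>2) < (\<Sum>i<n. b / n)"
        by (auto intro!: sum_strict_mono bounds simp del: sum_constant)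
      moreover have "z \<in> space ?P"
        using z by (simp add: space_PiM PiE_iff)
      ultimately show "z \<in> (\<lambda>z. \<Sum>i<n. (z i)\<^sup>2) -` {a<..<b} \<inter> space ?P"
        using assms(1) by simp
    qed
    show "(\<lambda>z. \<Sum>i<n. (z i)\<^sup>2) -` {a<..<b} \<inter> space ?P \<in> sets ?P"
      by (rule measurable_sets[OF measurable_sum_squares]) simp_all
  qed
  finally show ?thesis
    by (simp only: emeasure_chi_squared[OF borel_open[OF open_greaterThanLessThan]])
qed

lemma cdf_chi_squared_strict_mono:
  assumes "n \<ge> 1" "0 \<le> a" "a < b"
  shows "cdf (chi_squared n) a < cdf (chi_squared n) b"
proof -
  interpret real_distribution "chi_squared n"
    by (rule real_distribution_chi_squared)
  have "0 < measure (chi_squared n) {a<..<b}"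
    using emeasure_chi_squared_interval_pos[OF assms] by (simp add: emeasure_eq_measure)
  also have "\<dots> \<le> measure (chi_squared n) {a<..b}"
    by (rule finite_measure_mono) auto
  finally show ?thesis
    using cdf_diff_eq[OF \<open>a < b\<close>] by simp
qed

text \<open>A sum of squares is at most 0 only if it equals 0, and the point 0 carries no
  mass.\<close>

lemma cdf_chi_squared_zero:
  assumes "n \<ge> 1"
  shows "cdf (chi_squared n) 0 = 0"
proof -
  have "(\<lambda>z. \<Sum>i<n. (z i)\<^sup>2) -` {..0} = (\<lambda>z. \<Sum>i<n. (z i)\<^sup>2) -` {0 :: real}"
    by (auto intro!: antisym sum_nonneg)
  then have "emeasure (chi_squared n) {..0} = emeasure (chi_squared n) {0}"
    by (simp add: emeasure_chi_squared)
  then show ?thesis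
    using chi_squared_no_atoms[OF assms] by (simp add: cdf_def measure_def)
qed

lemma
  assumes "n \<ge> 1" "0 < \<beta>" "\<beta> < 1"
  shows cdf_quantile_chi_squared: "cdf (chi_squared n) (quantile (chi_squared n) \<beta>) = \<beta>"
    and quantile_chi_squared_pos: "0 < quantile (chi_squared n) \<beta>"
  by (rule real_distribution_cdf_quantile;
      use assms real_distribution_chi_squared chi_squared_no_atoms cdf_chi_squared_strict_mono
        cdf_chi_squared_zero in \<open>simp add: measure_def\<close>)+

text \<open>Acceptance is a strict inequality whereas \<open>cdf\<close> uses closed half-lines; the
  endpoint separating them is not an atom.\<close>

lemma measure_chi_squared_lessThan:
  assumes "n \<ge> 1"
  shows "measure (chi_squared n) {..<x} = cdf (chi_squared n) x"
proof -
  interpret real_distribution "chi_squared n"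
    by (rule real_distribution_chi_squared)
  have "cdf (chi_squared n) x = measure (chi_squared n) {..<x} + measure (chi_squared n) {x}"
    unfolding cdf_def ivl_disj_un(2)[symmetric] by (subst finite_measure_Union) auto
  then show ?thesis
    using chi_squared_no_atoms[OF assms] by (simp add: measure_def)
qed

lemma cdf_chi_squared_le_iff:
  assumes "n \<ge> 1" "0 \<le> a" "0 \<le> b"
  shows "cdf (chi_squared n) a \<le> cdf (chi_squared n) b \<longleftrightarrow> a \<le> b"
  using cdf_chi_squared_strict_mono[of n a b] cdf_chi_squared_strict_mono[of n b a] assms
  by (cases a b rule: linorder_cases) auto

section \<open>The chi-squared law of the rescaled test statistic\<close>

lemma (in prob_space) distr_sum_squares_std_normal:
  assumes "indep_vars (\<lambda>_. borel) Z {..<n}" "n \<ge> 1"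
    and Z: "\<And>i. i < n \<Longrightarrow> distributed M lborel (Z i) std_normal_density"
  shows "distr M borel (\<lambda>\<omega>. \<Sum>i<n. (Z i \<omega>)\<^sup>2) = chi_squared n"
proof -
  have rv: "random_variable borel (Z i)" if "i \<in> {..<n}" for i
    using Z[of i] that by (auto simp: distributed_def)
  have law: "distr M borel (Z i) = std_normal" if "i \<in> {..<n}" for i
  proof -
    have "distr M borel (Z i) = distr M lborel (Z i)"
      by (rule distr_cong) auto
    then show ?thesis
      using Z[of i] that by (simp add: distributed_def)
  qed
  \<comment> \<open>Independence is equivalent to the joint law being the product of the marginals,
    and this product is the measure pushed forward in \<open>chi_squared\<close>.\<close>
  have joint: "distr M (\<Pi>\<^sub>M i\<in>{..<n}. borel) (\<lambda>x. \<lambda>i\<in>{..<n}. Z i x) = (\<Pi>\<^sub>M i\<in>{..<n}. std_normal)"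
  proof -
    have "{..<n} \<noteq> {}"
      using assms(2) by (auto simp: lessThan_empty_iff)
    then have "distr M (\<Pi>\<^sub>M i\<in>{..<n}. borel) (\<lambda>x. \<lambda>i\<in>{..<n}. Z i x) = (\<Pi>\<^sub>M i\<in>{..<n}. distr M borel (Z i))"
      using assms(1) rv by (subst indep_vars_iff_distr_eq_PiM'[symmetric]) auto
    also have "\<dots> = (\<Pi>\<^sub>M i\<in>{..<n}. std_normal)"
      by (rule PiM_cong) (simp_all add: law)
    finally show ?thesis .
  qed
  have "chi_squared n = distr M borel ((\<lambda>z. \<Sum>i<n. (z i)\<^sup>2) \<circ> (\<lambda>x. \<lambda>i\<in>{..<n}. Z i x))"
    unfolding chi_squared_def joint[symmetric] using rv
    by (intro distr_distr measurable_sum_squares measurable_restrict) auto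
  also have "\<dots> = distr M borel (\<lambda>\<omega>. \<Sum>i<n. (Z i \<omega>)\<^sup>2)"
    by (rule distr_cong) auto
  finally show ?thesis ..
qed

text \<open>The two closed intervals overlap only in the null set \<open>{b}\<close>, so
  almost-everywhere disjointness suffices for additivity.\<close>

lemma set_lebesgue_integral_Icc_combine:
  fixes f :: "real \<Rightarrow> real"
  assumes "set_integrable lebesgue {a..c} f" "a \<le> b" "b \<le> c"
  shows "(LINT s:{a..c}|lebesgue. f s) = (LINT s:{a..b}|lebesgue. f s) + (LINT s:{b..c}|lebesgue. f s)"
proof -
  have "{b} \<in> null_sets lebesgue"
    by (simp add: null_sets_completionI)
  then have "AE s in lebesgue. s \<noteq> b"
    using AE_not_in by fastforce
  then have "AE s in lebesgue. \<not> (s \<in> {a..b} \<and> s \<in> {b..c})"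
    by eventually_elim auto
  moreover have "{a..b} \<union> {b..c} = {a..c}"
    using assms by auto
  moreover have "set_integrable lebesgue {a..b} f" "set_integrable lebesgue {b..c} f"
    using assms by (auto intro: set_integrable_subset)
  ultimately show ?thesis
    using set_integral_Un_AE[of "{a..b}" "{b..c}" lebesgue f] by simp
qed

lemma borel_measurable_test_statistic:
  assumes "\<And>t. t \<in> {0..real n * \<Delta>} \<Longrightarrow> X t \<in> borel_measurable M" "\<Delta> > 0"
  shows "test_statistic b X \<Delta> n \<in> borel_measurable M"
proof -
  have [measurable]: "X (real i * \<Delta>) \<in> borel_measurable M"
      "X ((real i - 1) * \<Delta>) \<in> borel_measurable M" if "i \<in> {1..n}" for i
    using that assms(2) by (auto intro!: assms(1) mult_right_mono)
  show ?thesis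
    unfolding test_statistic_def centered_increment_def by measurable
qed

text \<open>In the difference of two values of the path, \<open>x0\<close> and \<open>W 0\<close>
  cancel, and the difference of the drift integrals is exactly the integral subtracted in the
  centering.\<close>

lemma centered_increment_sde_solution:
  assumes X: "\<And>t. t \<in> {0..T} \<Longrightarrow>
      X t \<omega> = x0 + (LINT s:{0..t}|lebesgue. b s) + \<sigma> * (W t \<omega> - W 0 \<omega>)"
    and b: "set_integrable lebesgue {0..T} b"
    and "\<Delta> > 0" "real (Suc i) * \<Delta> \<le> T"
  shows "centered_increment b X \<Delta> (Suc i) \<omega> =
    \<sigma> * ((W (real (Suc i) * \<Delta>) \<omega> - W (real i * \<Delta>) \<omega>) / sqrt \<Delta>)"
proof -
  have le: "0 \<le> real i * \<Delta>" "real i * \<Delta> \<le> real (Suc i) * \<Delta>"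
    using \<open>\<Delta> > 0\<close> by (auto intro: mult_right_mono)
  have "set_integrable lebesgue {0..real (Suc i) * \<Delta>} b"
    using assms(4) by (intro set_integrable_subset[OF b]) auto
  from set_lebesgue_integral_Icc_combine[OF this le]
  have "X (real (Suc i) * \<Delta>) \<omega> - X (real i * \<Delta>) \<omega>
      - (LINT s:{real i * \<Delta>..real (Suc i) * \<Delta>}|lebesgue. b s)
      = \<sigma> * (W (real (Suc i) * \<Delta>) \<omega> - W (real i * \<Delta>) \<omega>)"
    using X[of "real i * \<Delta>"] X[of "real (Suc i) * \<Delta>"] le assms(4)
    by (simp add: algebra_simps)
  then show ?thesis
    by (simp add: centered_increment_def)
qed

lemma (in brownian_motion) distr_sum_squared_increments:
  assumes "\<Delta> > 0" "n \<ge> 1"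
  shows "distr M borel (\<lambda>\<omega>. \<Sum>i<n. ((W (real (Suc i) * \<Delta>) \<omega> - W (real i * \<Delta>) \<omega>) / sqrt \<Delta>)\<^sup>2)
    = chi_squared n"
proof (rule distr_sum_squares_std_normal[OF _ assms(2)])
  \<comment> \<open>Independence of increments is applied to the infinite grid of multiples of
    \<open>\<Delta>\<close>; rescaling each increment and keeping the first \<open>n\<close>
    preserves it.\<close>
  have "indep_vars (\<lambda>_. borel) (\<lambda>i \<omega>. W (real (Suc i) * \<Delta>) \<omega> - W (real i * \<Delta>) \<omega>) UNIV"
    using assms(1) by (intro indep_increments incseq_SucI mult_right_mono) auto
  from indep_vars_compose2[OF this, of "\<lambda>_ x. x / sqrt \<Delta>" "\<lambda>_. borel"]
  show "indep_vars (\<lambda>_. borel) (\<lambda>i \<omega>. (W (real (Suc i) * \<Delta>) \<omega> - W (real i * \<Delta>) \<omega>) / sqrt \<Delta>) {..<n}"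
    by (intro indep_vars_subset[where I = UNIV and J = "{..<n}"]) simp_all
next
  fix i
  have "distributed M lborel (\<lambda>\<omega>. W (real (Suc i) * \<Delta>) \<omega> - W (real i * \<Delta>) \<omega>)
      (normal_density 0 (sqrt (real (Suc i) * \<Delta> - real i * \<Delta>)))"
    using assms(1) by (intro normal_increments) auto
  moreover have "real (Suc i) * \<Delta> - real i * \<Delta> = \<Delta>"
    by (simp add: algebra_simps)
  ultimately show "distributed M lborel
      (\<lambda>\<omega>. (W (real (Suc i) * \<Delta>) \<omega> - W (real i * \<Delta>) \<omega>) / sqrt \<Delta>) std_normal_density"
    using normal_standard_normal_convert[of "sqrt \<Delta>" _ 0] assms(1) by simp
qed

lemma distr_test_statistic:
  assumes "brownian_motion M W" "sde_solution M W b \<sigma> x0 T X" "\<sigma> \<noteq> 0"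
    and "\<Delta> > 0" "n \<ge> 1" "real n * \<Delta> = T" "set_integrable lebesgue {0..T} b"
  shows "test_statistic b X \<Delta> n \<in> borel_measurable M"
    and "distr M borel (\<lambda>\<omega>. real n / \<sigma>\<^sup>2 * test_statistic b X \<Delta> n \<omega>) = chi_squared n"
proof -
  interpret brownian_motion M W by fact
  show meas[measurable]: "test_statistic b X \<Delta> n \<in> borel_measurable M"
    using assms by (intro borel_measurable_test_statistic) (auto simp: sde_solution_def)
  let ?Z = "\<lambda>i \<omega>. (W (real (Suc i) * \<Delta>) \<omega> - W (real i * \<Delta>) \<omega>) / sqrt \<Delta>"
  \<comment> \<open>The quantifier over \<open>t\<close> stands inside \<open>AE\<close>, so one
    exceptional null set serves all observation times.\<close>
  have "AE \<omega> in M. \<forall>t\<in>{0..T}.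
      X t \<omega> = x0 + (LINT s:{0..t}|lebesgue. b s) + \<sigma> * (W t \<omega> - W 0 \<omega>)"
    using assms(2) by (simp add: sde_solution_def)
  then have "AE \<omega> in M. real n / \<sigma>\<^sup>2 * test_statistic b X \<Delta> n \<omega> = (\<Sum>i<n. (?Z i \<omega>)\<^sup>2)"
  proof eventually_elim
    case (elim \<omega>)
    have "centered_increment b X \<Delta> (Suc i) \<omega> = \<sigma> * ?Z i \<omega>" if "i < n" for i
    proof (rule centered_increment_sde_solution)
      show "real (Suc i) * \<Delta> \<le> T"
        unfolding assms(6)[symmetric] using that assms(4) by (intro mult_right_mono) auto
    qed (use elim assms in auto)
    \<comment> \<open>Squaring removes the sign of \<open>\<sigma>\<close>, which the model leaves
      open. The index is shifted because the statistic sums over \<open>1..n\<close> and the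
      Brownian increments start at 0.\<close>
    then have "(\<Sum>i<n. (centered_increment b X \<Delta> (Suc i) \<omega>)\<^sup>2) = \<sigma>\<^sup>2 * (\<Sum>i<n. (?Z i \<omega>)\<^sup>2)"
      unfolding sum_distrib_left by (intro sum.cong refl) (simp only: lessThan_iff power_mult_distrib)
    moreover have "(\<Sum>i=1..n. (centered_increment b X \<Delta> i \<omega>)\<^sup>2) =
        (\<Sum>i<n. (centered_increment b X \<Delta> (Suc i) \<omega>)\<^sup>2)"
      by (simp add: sum.atLeast1_atMost_eq)
    ultimately show ?case
      using assms(3,5) by (simp add: test_statistic_def)
  qed
  moreover have "(\<lambda>\<omega>. \<Sum>i<n. (?Z i \<omega>)\<^sup>2) \<in> borel_measurable M"
    using assms(4) random_variable
    by (intro borel_measurable_sum borel_measurable_power borel_measurable_divide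
        borel_measurable_diff) auto
  ultimately have "distr M borel (\<lambda>\<omega>. real n / \<sigma>\<^sup>2 * test_statistic b X \<Delta> n \<omega>) =
      distr M borel (\<lambda>\<omega>. \<Sum>i<n. (?Z i \<omega>)\<^sup>2)"
    by (intro distr_cong_AE) simp_all
  then show "distr M borel (\<lambda>\<omega>. real n / \<sigma>\<^sup>2 * test_statistic b X \<Delta> n \<omega>) = chi_squared n"
    using distr_sum_squared_increments assms by simp
qed

section \<open>Rejection and acceptance probabilities\<close>

lemma prob_test_statistic_less:
  assumes "diffusion_model P b x0 T X" "v > 0"
    and "\<Delta> > 0" "n \<ge> 1" "real n * \<Delta> = T" "set_integrable lebesgue {0..T} b"
  shows "\<P>(\<omega> in P v. test_statistic b X \<Delta> n \<omega> < c) = cdf (chi_squared n) (real n / v * c)"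
    and "\<P>(\<omega> in P v. c \<le> test_statistic b X \<Delta> n \<omega>) = 1 - cdf (chi_squared n) (real n / v * c)"
proof -
  obtain W \<sigma> where W: "\<sigma>\<^sup>2 = v" "brownian_motion (P v) W" "sde_solution (P v) W b \<sigma> x0 T X"
    using assms(1,2) by (auto simp: diffusion_model_def)
  interpret brownian_motion "P v" W by fact
  have "\<sigma> \<noteq> 0"
    using W(1) assms(2) by auto
  note law = distr_test_statistic[OF W(2,3) this assms(3-6), unfolded W(1)]
  have [measurable]: "test_statistic b X \<Delta> n \<in> borel_measurable (P v)"
    by (rule law)
  have pos: "0 < real n / v"
    using assms by simp
  \<comment> \<open>Multiplication by the positive factor \<open>real n / v\<close> turns the event
    into one about the chi-squared variable.\<close>
  have "\<P>(\<omega> in P v. test_statistic b X \<Delta> n \<omega> < c) = measure (chi_squared n) {..<real n / v * c}"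
    unfolding law(2)[symmetric] using pos
    by (subst measure_distr) (auto intro!: arg_cong[where f = "measure (P v)"]
        simp del: times_divide_eq_left)
  then show less: "\<P>(\<omega> in P v. test_statistic b X \<Delta> n \<omega> < c) = cdf (chi_squared n) (real n / v * c)"
    using measure_chi_squared_lessThan assms(4) by simp
  show "\<P>(\<omega> in P v. c \<le> test_statistic b X \<Delta> n \<omega>) = 1 - cdf (chi_squared n) (real n / v * c)"
    unfolding less[symmetric] by (subst prob_neg[symmetric]) (simp_all add: not_less)
qed

theorem proposition2:
  fixes P :: "real \<Rightarrow> 'a measure" and X :: "real \<Rightarrow> 'a \<Rightarrow> real" and b :: "real \<Rightarrow> real"
    and x0 \<Delta> T v0 \<alpha> :: real and n :: nat
  assumes "\<Delta> > 0" and "n \<ge> 1" and "real n * \<Delta> = T"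
    and "set_integrable lebesgue {0..T} b"
    and "diffusion_model P b x0 T X"
    and "0 < \<alpha>" and "\<alpha> < 1" and "v0 > 0"
  shows "\<P>(\<omega> in P v0. test_statistic b X \<Delta> n \<omega> \<ge> critical_value v0 n \<alpha>) = \<alpha> \<and>
    has_level P {v0} (rejects b X \<Delta> n v0 \<alpha>) \<alpha> \<and>
    (\<forall>\<beta>. 0 < \<beta> \<and> \<beta> < 1 \<and> 1 - \<beta> \<ge> \<alpha> \<longrightarrow>
      (\<forall>v>0. \<P>(\<omega> in P v. \<not> rejects b X \<Delta> n v0 \<alpha> \<omega>) \<le> \<beta> \<longleftrightarrow>
        v \<ge> quantile (chi_squared n) (1 - \<alpha>) / quantile (chi_squared n) \<beta> * v0))"
proof (intro conjI allI impI)
  let ?q = "quantile (chi_squared n)"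
  note prob = prob_test_statistic_less[OF assms(5) _ assms(1-4)]
  have q: "cdf (chi_squared n) (?q \<beta>) = \<beta>" "0 < ?q \<beta>" if "0 < \<beta>" "\<beta> < 1" for \<beta>
    using cdf_quantile_chi_squared quantile_chi_squared_pos that assms(2) by auto
  \<comment> \<open>The factor \<open>n\<close> cancels against the normalization of the critical
    value. At \<open>v = v0\<close> what remains is the quantile itself, so the rejection
    probability becomes \<open>1 - (1 - \<alpha>)\<close>.\<close>
  have crit: "real n / v * critical_value v0 n \<alpha> = v0 * ?q (1 - \<alpha>) / v" for v
    using assms(2) by (simp add: critical_value_def)
  show type_I: "\<P>(\<omega> in P v0. test_statistic b X \<Delta> n \<omega> \<ge> critical_value v0 n \<alpha>) = \<alpha>"
    using q(1)[of "1 - \<alpha>"] assms(6-8) by (simp add: prob(2) crit del: times_divide_eq_left)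
  then show "has_level P {v0} (rejects b X \<Delta> n v0 \<alpha>) \<alpha>"
    by (simp add: has_level_def rejects_def)
  fix \<beta> v :: real
  assume \<beta>: "0 < \<beta> \<and> \<beta> < 1 \<and> 1 - \<beta> \<ge> \<alpha>" and v: "v > 0"
  have "\<P>(\<omega> in P v. \<not> rejects b X \<Delta> n v0 \<alpha> \<omega>) = cdf (chi_squared n) (v0 * ?q (1 - \<alpha>) / v)"
    using prob(1)[OF v] by (simp add: rejects_def not_le crit del: times_divide_eq_left)
  then have "\<P>(\<omega> in P v. \<not> rejects b X \<Delta> n v0 \<alpha> \<omega>) \<le> \<beta> \<longleftrightarrow>
      cdf (chi_squared n) (v0 * ?q (1 - \<alpha>) / v) \<le> cdf (chi_squared n) (?q \<beta>)"
    using q(1)[of \<beta>] \<beta> by simp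
  \<comment> \<open>Both arguments are nonnegative because the quantiles are positive, so strict
    growth gives an equivalence; this yields necessity as well as sufficiency.\<close>
  also have "\<dots> \<longleftrightarrow> v0 * ?q (1 - \<alpha>) / v \<le> ?q \<beta>"
    using q(2)[of \<beta>] q(2)[of "1 - \<alpha>"] \<beta> v assms
    by (intro cdf_chi_squared_le_iff) auto
  also have "\<dots> \<longleftrightarrow> v \<ge> ?q (1 - \<alpha>) / ?q \<beta> * v0"
    using q(2)[of \<beta>] \<beta> v by (simp add: field_simps)
  finally show "\<P>(\<omega> in P v. \<not> rejects b X \<Delta> n v0 \<alpha> \<omega>) \<le> \<beta> \<longleftrightarrow>
      v \<ge> ?q (1 - \<alpha>) / ?q \<beta> * v0" .
qed

end
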